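(* Consider the kinetic equation $$\partial_t f(x,t)-\partial_x f(x,t) = -\frac{f(0,t)}{M(t)}\,f(x,t),\quad 0<x<\infty,\qquad M(t)=\int_0^\infty f(x,t)\,dx, \tag{KE}$$ for a positive density $f(x,t)$ with initial condition $f(x,0)=f_0(x)$. (a) Assume $f_0\in L^1_+\cap C^1$. There exists a unique solution to (KE) with $f(x,0)=f_0(x)$. The solution is given by the formula $$f(x,t)=\rho(t)\,f_0(x+t),\qquad \rho(t)=\frac{\int_t^\infty f_0(y)\,dy}{\int_0^\infty f_0(s)\,ds}. \tag{SF}$$ (b) The formula (SF) defines a continuous dynamical system in $L^1_+$. That is, the map $(t,f_0)\mapsto f(\cdot,t)$ is in $C([0,\infty)\times L^1_+,\,L^1_+)$.
   Context: $L^1_+$ denotes the cone of non-negative functions in $L^1(0,\infty)$, equipped with the norm topology. Part (a) concerns classical solutions of (KE); in part (b) the formula (SF) is used to define solutions for arbitrary initial data in $L^1_+$. *)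

theory Defs
  imports "HOL-Analysis.Analysis"
begin

section \<open>The space \<open>L\<^sup>1(0,\<infinity>)\<close>\<close>

definition l1_eq :: "(real \<Rightarrow> real) \<Rightarrow> (real \<Rightarrow> real) \<Rightarrow> bool" where
  "l1_eq f g \<longleftrightarrow>
     set_integrable lborel {0<..} f \<and> set_integrable lborel {0<..} g \<and>
     (AE x\<in>{0<..} in lborel. f x = g x)"

lemma l1_eq_integrable: "l1_eq f g \<Longrightarrow> set_integrable lborel {0<..} f"
  "l1_eq f g \<Longrightarrow> set_integrable lborel {0<..} g"
  by (auto simp: l1_eq_def)

quotient_type l1 = "real \<Rightarrow> real" / partial: l1_eq
proof (rule part_equivpI)
  show "\<exists>f. l1_eq f f"
    by (rule exI[of _ "\<lambda>_. 0"]) (simp add: l1_eq_def set_integrable_def)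
  show "symp l1_eq"
    by (auto simp: symp_def l1_eq_def elim: eventually_mono)
  show "transp l1_eq"
    unfolding transp_def l1_eq_def by (auto elim: eventually_elim2)
qed

lemma l1_eq_set_integral:
  assumes "l1_eq f g" and [measurable]: "A \<in> sets borel" and "A \<subseteq> {0<..}"
  shows "(LBINT x:A. f x) = (LBINT x:A. g x)"
proof -
  have i: "set_integrable lborel A f" "set_integrable lborel A g"
    using assms by (auto simp: l1_eq_def intro: set_integrable_subset)
  have "AE x in lborel. indicator A x *\<^sub>R f x = indicator A x *\<^sub>R g x"
    using assms unfolding l1_eq_def by (auto simp: indicator_def elim!: eventually_mono)
  with i show ?thesis
    unfolding set_lebesgue_integral_def set_integrable_def
    by (intro integral_cong_AE borel_measurable_integrable)
qed

instantiation l1 :: real_normed_vector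
begin

lift_definition norm_l1 :: "l1 \<Rightarrow> real" is "\<lambda>f. LBINT x:{0<..}. \<bar>f x\<bar>"
proof -
  fix f g assume "l1_eq f g"
  then have "l1_eq (\<lambda>x. \<bar>f x\<bar>) (\<lambda>x. \<bar>g x\<bar>)"
    by (auto simp: l1_eq_def intro: set_integrable_abs elim!: eventually_mono)
  then show "(LBINT x:{0<..}. \<bar>f x\<bar>) = (LBINT x:{0<..}. \<bar>g x\<bar>)"
    by (rule l1_eq_set_integral) auto
qed

lift_definition zero_l1 :: l1 is "\<lambda>_. 0"
  by (simp add: l1_eq_def set_integrable_def)

lift_definition plus_l1 :: "l1 \<Rightarrow> l1 \<Rightarrow> l1" is "\<lambda>f g x. f x + g x"
  unfolding l1_eq_def by (auto elim: eventually_elim2)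

lift_definition minus_l1 :: "l1 \<Rightarrow> l1 \<Rightarrow> l1" is "\<lambda>f g x. f x - g x"
  unfolding l1_eq_def by (auto elim: eventually_elim2)

lift_definition uminus_l1 :: "l1 \<Rightarrow> l1" is "\<lambda>f x. - f x"
  unfolding l1_eq_def by (auto simp: set_integrable_def elim!: eventually_mono)

lift_definition scaleR_l1 :: "real \<Rightarrow> l1 \<Rightarrow> l1" is "\<lambda>c f x. c * f x"
  unfolding l1_eq_def by (auto elim!: eventually_mono)

definition sgn_l1 :: "l1 \<Rightarrow> l1" where
  "sgn_l1 u = scaleR (inverse (norm u)) u"

definition dist_l1 :: "l1 \<Rightarrow> l1 \<Rightarrow> real" where
  "dist_l1 u v = norm (u - v)"

definition uniformity_l1 :: "(l1 \<times> l1) filter" where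
  "uniformity_l1 = (INF e\<in>{0<..}. principal {(u, v). dist u v < e})"

definition open_l1 :: "l1 set \<Rightarrow> bool" where
  "open_l1 U = (\<forall>u\<in>U. \<forall>\<^sub>F (u', v) in uniformity. u' = u \<longrightarrow> v \<in> U)"

instance
proof
  fix u v w :: l1 and a b :: real
  show "u + v + w = u + (v + w)" "u + v = v + u" "0 + u = u" "- u + u = 0" "u - v = u + - v"
    "a *\<^sub>R (u + v) = a *\<^sub>R u + a *\<^sub>R v" "(a + b) *\<^sub>R u = a *\<^sub>R u + b *\<^sub>R u"
    "a *\<^sub>R (b *\<^sub>R u) = (a * b) *\<^sub>R u" "1 *\<^sub>R u = u"
    by (transfer; auto simp: l1_eq_def algebra_simps set_integrable_def)+
  show "sgn u = inverse (norm u) *\<^sub>R u" by (rule sgn_l1_def)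
  show "dist u v = norm (u - v)" by (rule dist_l1_def)
  show "uniformity = (INF e\<in>{0<..}. principal {(u :: l1, v). dist u v < e})"
    by (rule uniformity_l1_def)
  show "open U = (\<forall>u\<in>U. \<forall>\<^sub>F (u', v) in uniformity. u' = u \<longrightarrow> v \<in> U)" for U :: "l1 set"
    by (rule open_l1_def)
  show "norm u = 0 \<longleftrightarrow> u = 0"
  proof transfer
    fix f assume "l1_eq f f"
    then have i: "set_integrable lborel {0<..} f" by (rule l1_eq_integrable)
    then have "integrable lborel (\<lambda>x. indicator {0<..} x *\<^sub>R \<bar>f x\<bar>)"
      using set_integrable_abs unfolding set_integrable_def by blast
    then have "(LBINT x:{0<..}. \<bar>f x\<bar>) = 0 \<longleftrightarrow>
        (AE x in lborel. indicator {0<..} x *\<^sub>R \<bar>f x\<bar> = 0)"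
      unfolding set_lebesgue_integral_def by (rule integral_nonneg_eq_0_iff_AE) auto
    also have "\<dots> \<longleftrightarrow> (AE x\<in>{0<..} in lborel. f x = 0)"
      by (rule AE_cong) (auto simp: indicator_def)
    finally show "(LBINT x:{0<..}. \<bar>f x\<bar>) = 0 \<longleftrightarrow> l1_eq f (\<lambda>_. 0)"
      using i by (simp add: l1_eq_def) (simp add: set_integrable_def)
  qed
  show "norm (u + v) \<le> norm u + norm v"
  proof transfer
    fix f g assume "l1_eq f f" "l1_eq g g"
    then have i: "set_integrable lborel {0<..} f" "set_integrable lborel {0<..} g"
      by (auto dest: l1_eq_integrable)
    then have "(LBINT x:{0<..}. \<bar>f x + g x\<bar>) \<le> (LBINT x:{0<..}. \<bar>f x\<bar> + \<bar>g x\<bar>)"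
      by (intro set_integral_mono) (auto intro!: set_integrable_abs)
    also have "\<dots> = (LBINT x:{0<..}. \<bar>f x\<bar>) + (LBINT x:{0<..}. \<bar>g x\<bar>)"
      by (intro set_integral_add set_integrable_abs i)
    finally show "(LBINT x:{0<..}. \<bar>f x + g x\<bar>) \<le> (LBINT x:{0<..}. \<bar>f x\<bar>) + (LBINT x:{0<..}. \<bar>g x\<bar>)" .
  qed
  show "norm (a *\<^sub>R u) = \<bar>a\<bar> * norm u"
    by transfer (simp add: abs_mult)
qed

end

lift_definition l1_nonneg :: "l1 \<Rightarrow> bool" is "\<lambda>f. AE x\<in>{0<..} in lborel. 0 \<le> f x"
  unfolding l1_eq_def by (auto elim: eventually_elim2)

definition L1_plus :: "l1 set" where
  "L1_plus = {u. l1_nonneg u}"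


section \<open>The solution formula\<close>

text \<open>
  If \<open>f0\<close> vanishes almost everywhere, the quotient in \<open>rho\<close> is \<open>0 / 0 = 0\<close>, so the formula
  then gives the zero solution.
\<close>

definition rho :: "(real \<Rightarrow> real) \<Rightarrow> real \<Rightarrow> real" where
  "rho f0 t = (LBINT y:{t<..}. f0 y) / (LBINT s:{0<..}. f0 s)"

definition sol_formula :: "(real \<Rightarrow> real) \<Rightarrow> real \<Rightarrow> real \<Rightarrow> real" where
  "sol_formula f0 x t = rho f0 t * f0 (x + t)"

lemma l1_eq_shift:
  assumes "l1_eq f g" and t: "0 \<le> t"
  shows "l1_eq (\<lambda>x. f (x + t)) (\<lambda>x. g (x + t))"
proof -
  let ?i = "indicator {0<..} :: real \<Rightarrow> real"
  have shift: "set_integrable lborel {0<..} (\<lambda>x. h (x + t))"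
    if "set_integrable lborel {0<..} h" for h :: "real \<Rightarrow> real"
  proof -
    have "set_integrable lborel {t<..} h"
      by (rule set_integrable_subset[OF that]) (use t in auto)
    then have "integrable lborel (\<lambda>x. indicator {t<..} (t + 1 * x) *\<^sub>R h (t + 1 * x))"
      unfolding set_integrable_def by (rule lborel_integrable_real_affine) simp
    also have "(\<lambda>x. indicator {t<..} (t + 1 * x) *\<^sub>R h (t + 1 * x)) = (\<lambda>x. ?i x *\<^sub>R h (x + t))"
      by (auto simp: indicator_def add.commute)
    finally show ?thesis by (simp add: set_integrable_def)
  qed
  have [measurable]: "(\<lambda>x. ?i x * f x) \<in> borel_measurable borel"
    "(\<lambda>x. ?i x * g x) \<in> borel_measurable borel"
    using assms(1)[THEN l1_eq_integrable(1)] assms(1)[THEN l1_eq_integrable(2)]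
    by (auto simp: set_integrable_def dest!: borel_measurable_integrable)
  have "AE x in lborel. ?i x * f x = ?i x * g x"
    using assms(1) unfolding l1_eq_def by (auto simp: indicator_def elim!: eventually_mono)
  then have "AE x in lborel. ?i (t + 1 * x) * f (t + 1 * x) = ?i (t + 1 * x) * g (t + 1 * x)"
    by (intro AE_borel_affine[where P = "\<lambda>x. ?i x * f x = ?i x * g x"]) (simp, measurable)
  then have "AE x\<in>{0<..} in lborel. f (x + t) = g (x + t)"
    using t by (auto simp: indicator_def add.commute elim!: eventually_mono)
  with assms(1) shift show ?thesis by (auto simp: l1_eq_def)
qed

text \<open>
  The class of \<open>x \<mapsto> sol_formula f0 x t\<close> depends only on the class of \<open>f0\<close>.
  The value at negative times is a dummy.
\<close>

lift_definition flow :: "real \<Rightarrow> l1 \<Rightarrow> l1" is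
  "\<lambda>t f0. if 0 \<le> t then (\<lambda>x. sol_formula f0 x t) else (\<lambda>_. 0)"
proof -
  fix t :: real and f g assume fg: "l1_eq f g"
  show "l1_eq (if 0 \<le> t then (\<lambda>x. sol_formula f x t) else (\<lambda>_. 0))
              (if 0 \<le> t then (\<lambda>x. sol_formula g x t) else (\<lambda>_. 0))"
  proof (cases "0 \<le> t")
    case True
    have "(LBINT x:{0<..}. f x) = (LBINT x:{0<..}. g x)" "(LBINT x:{t<..}. f x) = (LBINT x:{t<..}. g x)"
      using True by (auto intro!: l1_eq_set_integral[OF fg])
    then have "rho f t = rho g t" by (simp add: rho_def)
    with l1_eq_shift[OF fg True] True show ?thesis
      by (auto simp: l1_eq_def sol_formula_def elim!: eventually_mono)
  qed (simp add: l1_eq_def set_integrable_def)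
qed


section \<open>Classical solutions\<close>

text \<open>
  Continuous differentiability on a set that need not be open. On \<open>[0,\<infinity>)\<close> and on
  \<open>[0,\<infinity>) \<times> [0,\<infinity>)\<close> this means C1 up to the boundary, with one-sided derivatives there.
\<close>

definition C1_on :: "'a::real_normed_vector set \<Rightarrow> ('a \<Rightarrow> 'b::real_normed_vector) \<Rightarrow> bool" where
  "C1_on S f \<longleftrightarrow>
     (\<exists>f' :: 'a \<Rightarrow> 'a \<Rightarrow>\<^sub>L 'b.
        (\<forall>x\<in>S. (f has_derivative blinfun_apply (f' x)) (at x within S)) \<and> continuous_on S f')"

definition mass :: "(real \<Rightarrow> real \<Rightarrow> real) \<Rightarrow> real \<Rightarrow> real" where
  "mass f t = (LBINT x:{0<..}. f x t)"

text \<open>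
  A density may die out in finite time. When \<open>mass f t = 0\<close>, nonnegativity and continuity
  force \<open>f x t = 0\<close> for all \<open>x \<ge> 0\<close>, so the right-hand side of the equation is zero whatever
  value the quotient \<open>0 / 0\<close> has.
\<close>

definition classical_solution :: "(real \<Rightarrow> real) \<Rightarrow> (real \<Rightarrow> real \<Rightarrow> real) \<Rightarrow> bool" where
  "classical_solution f0 f \<longleftrightarrow>
     C1_on ({0..} \<times> {0..}) (\<lambda>(x, t). f x t) \<and>
     (\<forall>x\<ge>0. \<forall>t\<ge>0. 0 \<le> f x t) \<and>
     (\<forall>t\<ge>0. set_integrable lborel {0<..} (\<lambda>x. f x t)) \<and>
     (\<forall>x\<ge>0. f x 0 = f0 x) \<and>
     (\<forall>x>0. \<forall>t>0. deriv (\<lambda>s. f x s) t - deriv (\<lambda>y. f y t) x = - (f 0 t / mass f t) * f x t)"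


section \<open>Continuous dynamical systems\<close>

definition continuous_dynamical_system_on ::
    "'a::topological_space set \<Rightarrow> (real \<Rightarrow> 'a \<Rightarrow> 'a) \<Rightarrow> bool" where
  "continuous_dynamical_system_on X \<Phi> \<longleftrightarrow>
     (\<forall>t\<ge>0. \<forall>u\<in>X. \<Phi> t u \<in> X) \<and>
     (\<forall>u\<in>X. \<Phi> 0 u = u) \<and>
     (\<forall>s\<ge>0. \<forall>t\<ge>0. \<forall>u\<in>X. \<Phi> (s + t) u = \<Phi> s (\<Phi> t u)) \<and>
     continuous_on ({0..} \<times> X) (\<lambda>(t, u). \<Phi> t u)"

end

theory Submission
  imports Defs
begin

text \<open>
  Let \<open>F t\<close> be the integral of \<open>f0\<close> over \<open>(t, \<infinity>)\<close>, called \<open>tail_mass f0 t\<close> below. Then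
  \<open>rho f0 t = F t / F 0\<close>, the mass of the formula at time \<open>t\<close> is \<open>rho f0 t * F t\<close>, and
  \<open>F' = - f0\<close>. Hence, as long as \<open>F t > 0\<close>, the loss rate \<open>f(0,t) / M(t)\<close> of the formula
  equals \<open>f0 t / F t\<close>, which is the logarithmic decay rate of \<open>rho\<close>; this is the kinetic
  equation. Once \<open>F t = 0\<close>, the formula and both sides of the equation vanish.

  For uniqueness, follow a solution along a characteristic: \<open>along y s = f (y - s) s\<close>. All
  characteristics obey the same linear equation \<open>\<partial>\<^sub>s along y s = - a s * along y s\<close> with
  the unknown rate \<open>a s = f 0 s / mass f s\<close>. So each \<open>along y\<close> decreases from \<open>f0 y\<close>, and the
  ratio of two characteristics does not change as long as one of them stays positive. Therefore
  the solution at time \<open>s\<close> is a multiple of the shifted datum, the multiple cancels in the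
  quotient, and \<open>a s = f0 s / F s\<close> is forced: \<open>along y / F\<close> is constant, which is the formula.
  The argument starts from a positive characteristic and shows at the same time that
  it stays positive: at a first zero the formula would already hold by continuity, but the formula
  is positive there.

  For the dynamical system the flow is read as a normalised shift. If \<open>T t\<close> denotes the left
  shift on \<open>L\<^sup>1(0,\<infinity>)\<close> (\<open>l1_shift\<close>), then for nonnegative \<open>u\<close>
  the flow at time \<open>t\<close> is \<open>(norm (T t u) / norm u) * T t u\<close>, by \<open>flow_eq_shift\<close>. The
  semigroup law is the one of \<open>T\<close>, since the scalar factors telescope. Joint continuity at \<open>u \<noteq> 0\<close> is the strong continuity of the
  contraction semigroup \<open>T\<close>, which rests on the continuity of translation in \<open>L\<^sup>1\<close>; at
  \<open>u = 0\<close>, where the quotient is singular, it follows from \<open>norm (flow t u) \<le> norm u\<close>.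
\<close>

section \<open>Continuity of translation in \<open>L\<^sup>1\<close>\<close>

lemma
  fixes f :: "'a::euclidean_space \<Rightarrow> 'b::{banach, second_countable_topology}"
  assumes f: "integrable lborel f"
  shows integrable_lborel_translate: "integrable lborel (\<lambda>x. f (x + h))"
    and integral_lborel_translate: "(\<integral>x. f (x + h) \<partial>lborel) = (\<integral>x. f x \<partial>lborel)"
proof -
  have [measurable]: "f \<in> borel_measurable borel"
    using borel_measurable_integrable[OF f] by simp
  have d: "distr lborel borel ((+) h) = (lborel :: 'a measure)"
    by (rule lborel_distr_plus)
  have "integrable (distr lborel borel ((+) h)) f"
    unfolding d by (rule f)
  then have "integrable lborel (\<lambda>x. f (h + x))"
    by (subst (asm) integrable_distr_eq) auto
  then show "integrable lborel (\<lambda>x. f (x + h))"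
    by (simp add: add.commute)
  have "(\<integral>x. f x \<partial>distr lborel borel ((+) h)) = (\<integral>x. f (h + x) \<partial>lborel)"
    by (rule integral_distr) auto
  then show "(\<integral>x. f (x + h) \<partial>lborel) = (\<integral>x. f x \<partial>lborel)"
    unfolding d by (simp add: add.commute)
qed

text \<open>
  Translations are isometries, so replacing \<open>g\<close> by \<open>f\<close> changes the \<open>L\<^sup>1\<close>-distance to the translate
  by at most twice the distance of \<open>f\<close> and \<open>g\<close>. Hence the functions with continuous
  translates form a closed set, and it suffices to treat a dense class.
\<close>

lemma translation_continuous_L1_approx:
  fixes f :: "'a::euclidean_space \<Rightarrow> 'b::{banach, second_countable_topology}"
  assumes f: "integrable lborel f"
    and approx: "\<And>e. e > 0 \<Longrightarrow> \<exists>g. integrable lborel g \<and> (\<integral>x. norm (f x - g x) \<partial>lborel) < e \<and>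
      (\<lambda>n. \<integral>x. norm (g (x + h n) - g x) \<partial>lborel) \<longlonglongrightarrow> 0"
  shows "(\<lambda>n. \<integral>x. norm (f (x + h n) - f x) \<partial>lborel) \<longlonglongrightarrow> 0"
proof (rule LIMSEQ_I)
  fix r :: real assume r: "0 < r"
  obtain g where g: "integrable lborel g" and fg: "(\<integral>x. norm (f x - g x) \<partial>lborel) < r/3"
    and lim: "(\<lambda>n. \<integral>x. norm (g (x + h n) - g x) \<partial>lborel) \<longlonglongrightarrow> 0"
    using approx[of "r/3"] r by auto
  obtain N where N: "\<And>n. n \<ge> N \<Longrightarrow> (\<integral>x. norm (g (x + h n) - g x) \<partial>lborel) < r/3"
    using LIMSEQ_D[OF lim, of "r/3"] r by auto
  have "norm ((\<integral>x. norm (f (x + h n) - f x) \<partial>lborel) - 0) < r" if n: "n \<ge> N" for n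
  proof -
    have d: "integrable lborel (\<lambda>x. norm (f x - g x))"
      using f g by auto
    have d': "integrable lborel (\<lambda>x. norm (f (x + h n) - g (x + h n)))"
      by (rule integrable_lborel_translate[OF d])
    have gn: "integrable lborel (\<lambda>x. norm (g (x + h n) - g x))"
      using g by (intro integrable_norm Bochner_Integration.integrable_diff integrable_lborel_translate)
    have fn: "integrable lborel (\<lambda>x. norm (f (x + h n) - f x))"
      using f by (intro integrable_norm Bochner_Integration.integrable_diff integrable_lborel_translate)
    have pt: "norm (f (x + h n) - f x) \<le> norm (f (x + h n) - g (x + h n))
          + norm (g (x + h n) - g x) + norm (f x - g x)" for x
      by norm
    have "(\<integral>x. norm (f (x + h n) - f x) \<partial>lborel)
        \<le> (\<integral>x. norm (f (x + h n) - g (x + h n)) + norm (g (x + h n) - g x) + norm (f x - g x) \<partial>lborel)"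
      by (rule integral_mono) (use fn d d' gn pt in auto)
    also have "\<dots> = (\<integral>x. norm (f (x + h n) - g (x + h n)) \<partial>lborel)
        + (\<integral>x. norm (g (x + h n) - g x) \<partial>lborel) + (\<integral>x. norm (f x - g x) \<partial>lborel)"
      using d d' gn by simp
    also have "(\<integral>x. norm (f (x + h n) - g (x + h n)) \<partial>lborel) = (\<integral>x. norm (f x - g x) \<partial>lborel)"
      by (rule integral_lborel_translate[OF d])
    finally have "(\<integral>x. norm (f (x + h n) - f x) \<partial>lborel) < r"
      using fg N[OF n] by linarith
    then show ?thesis by simp
  qed
  then show "\<exists>no. \<forall>n\<ge>no. norm ((\<integral>x. norm (f (x + h n) - f x) \<partial>lborel) - 0) < r"
    by blast
qed

text \<open>
  An open set and its translate have the same measure, so the \<open>L\<^sup>1\<close>-distance of their indicators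
  is twice the measure of the points that the translation pushes out of the set. That part is
  dominated by the indicator of the set and vanishes pointwise in the limit, as every point of an
  open set has a neighbourhood inside it.
\<close>

lemma translation_continuous_L1_open:
  fixes U :: "'a::euclidean_space set" and h :: "nat \<Rightarrow> 'a"
  assumes U: "open U" "emeasure lborel U < \<infinity>" and h: "h \<longlonglongrightarrow> 0"
  shows "(\<lambda>n. \<integral>x. \<bar>indicator U (x + h n) - indicator U x :: real\<bar> \<partial>lborel) \<longlonglongrightarrow> 0"
proof -
  let ?g = "indicator U :: 'a \<Rightarrow> real"
  have [measurable]: "U \<in> sets borel" using U by simp
  have g: "integrable lborel ?g"
    using U by (simp add: integrable_indicator_iff)
  have gn: "integrable lborel (\<lambda>x. ?g (x + h n))" for n
    by (rule integrable_lborel_translate[OF g])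
  have p: "integrable lborel (\<lambda>x. max 0 (?g x - ?g (x + h n)))" for n
    using g gn by (intro integrable_max) auto
  have eq: "(\<integral>x. \<bar>?g (x + h n) - ?g x\<bar> \<partial>lborel) = 2 * (\<integral>x. max 0 (?g x - ?g (x + h n)) \<partial>lborel)" for n
  proof -
    have "(\<integral>x. \<bar>?g (x + h n) - ?g x\<bar> \<partial>lborel)
        = (\<integral>x. 2 * max 0 (?g x - ?g (x + h n)) + (?g (x + h n) - ?g x) \<partial>lborel)"
      by (intro Bochner_Integration.integral_cong) (auto simp: max_def)
    also have "\<dots> = 2 * (\<integral>x. max 0 (?g x - ?g (x + h n)) \<partial>lborel)
        + ((\<integral>x. ?g (x + h n) \<partial>lborel) - (\<integral>x. ?g x \<partial>lborel))"
      using p[of n] gn[of n] g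
      by (subst Bochner_Integration.integral_add) (simp_all del: integral_indicator)
    also have "\<dots> = 2 * (\<integral>x. max 0 (?g x - ?g (x + h n)) \<partial>lborel)"
      using integral_lborel_translate[OF g, of "h n"] by simp
    finally show ?thesis .
  qed
  have "(\<lambda>n. \<integral>x. max 0 (?g x - ?g (x + h n)) \<partial>lborel) \<longlonglongrightarrow> (\<integral>x. 0 \<partial>(lborel :: 'a measure))"
  proof (rule integral_dominated_convergence[where w = ?g])
    show "AE x in lborel. (\<lambda>n. max 0 (?g x - ?g (x + h n))) \<longlonglongrightarrow> 0"
    proof (rule AE_I2)
      fix x :: 'a
      show "(\<lambda>n. max 0 (?g x - ?g (x + h n))) \<longlonglongrightarrow> 0"
      proof (cases "x \<in> U")
        case True
        have "(\<lambda>n. x + h n) \<longlonglongrightarrow> x"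
          using tendsto_add[OF tendsto_const h, of x] by simp
        then have "\<forall>\<^sub>F n in sequentially. x + h n \<in> U"
          using topological_tendstoD U True by blast
        then have "\<forall>\<^sub>F n in sequentially. max 0 (?g x - ?g (x + h n)) = 0"
          by eventually_elim (use True in auto)
        then show ?thesis by (rule tendsto_eventually)
      next
        case False
        then have "max 0 (?g x - ?g (x + h n)) = 0" for n by (simp add: indicator_def)
        then show ?thesis by simp
      qed
    qed
    show "\<And>n. AE x in lborel. norm (max 0 (?g x - ?g (x + h n))) \<le> ?g x"
      by (rule AE_I2) (auto simp: indicator_def)
  qed (use g p in \<open>auto intro!: borel_measurable_integrable\<close>)
  from tendsto_mult_left[OF this, of 2] show ?thesis
    by (simp add: eq)
qed

text \<open>
  Outer regularity passes from open sets to Borel sets of finite measure; simple functions and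
  dominated limits then exhaust the integrable functions.
\<close>

theorem translation_continuous_L1:
  fixes f :: "'a::euclidean_space \<Rightarrow> 'b::{banach, second_countable_topology}"
  assumes f: "integrable lborel f" and h: "h \<longlonglongrightarrow> 0"
  shows "(\<lambda>n. \<integral>x. norm (f (x + h n) - f x) \<partial>lborel) \<longlonglongrightarrow> 0"
  using f
proof (induction rule: integrable_induct)
  case (base A c)
  then have [measurable]: "A \<in> sets borel" by simp
  have iA: "integrable lborel (indicator A :: 'a \<Rightarrow> real)"
    using base by (simp add: integrable_indicator_iff)
  have A: "(\<lambda>n. \<integral>x. norm (indicator A (x + h n) - indicator A x :: real) \<partial>lborel) \<longlonglongrightarrow> 0"
  proof (rule translation_continuous_L1_approx[OF iA])
    fix e :: real assume e: "0 < e"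
    obtain U where U: "open U" "A \<subseteq> U" "emeasure lborel (U - A) < ennreal e"
      using outer_regular_lborel[of A e] e by auto
    then have [measurable]: "U \<in> sets borel" by simp
    have "emeasure lborel U = emeasure lborel A + emeasure lborel (U - A)"
      using U(2) by (subst plus_emeasure) (auto simp: Un_absorb1)
    also have "\<dots> < \<infinity>"
      using base U(3) by (auto simp: less_top[symmetric])
    finally have fin: "emeasure lborel U < \<infinity>" .
    then have iU: "integrable lborel (indicator U :: 'a \<Rightarrow> real)"
      by (simp add: integrable_indicator_iff)
    have "(\<integral>x. norm (indicator A x - indicator U x :: real) \<partial>lborel)
        = (\<integral>x. indicator (U - A) x \<partial>lborel)"
      using U(2) by (intro Bochner_Integration.integral_cong) (auto simp: indicator_def)
    also have "\<dots> = measure lborel (U - A)" by simp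
    also have "measure lborel (U - A) < e"
      using U(3) e by (subst ennreal_less_iff[symmetric], simp, subst emeasure_eq_ennreal_measure[symmetric]) auto
    finally show "\<exists>g. integrable lborel g \<and> (\<integral>x. norm (indicator A x - g x :: real) \<partial>lborel) < e \<and>
        (\<lambda>n. \<integral>x. norm (g (x + h n) - g x) \<partial>lborel) \<longlonglongrightarrow> 0"
      using iU translation_continuous_L1_open[OF U(1) fin h]
      by (intro exI[of _ "indicator U"]) simp
  qed
  have "norm (indicator A (x + h n) *\<^sub>R c - indicator A x *\<^sub>R c)
      = norm c * norm (indicator A (x + h n) - indicator A x :: real)" for x n
    by (simp add: scaleR_diff_left[symmetric])
  with tendsto_mult_left[OF A, of "norm c"] show ?case by simp
next
  case (add f g)
  have "(\<lambda>n. (\<integral>x. norm (f (x + h n) - f x) \<partial>lborel) + (\<integral>x. norm (g (x + h n) - g x) \<partial>lborel)) \<longlonglongrightarrow> 0"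
    using tendsto_add[OF add.IH] by simp
  moreover have "(\<integral>x. norm (f (x + h n) + g (x + h n) - (f x + g x)) \<partial>lborel)
      \<le> (\<integral>x. norm (f (x + h n) - f x) \<partial>lborel) + (\<integral>x. norm (g (x + h n) - g x) \<partial>lborel)" for n
  proof -
    have i: "integrable lborel (\<lambda>x. norm (f (x + h n) - f x))" "integrable lborel (\<lambda>x. norm (g (x + h n) - g x))"
      using add.hyps by (auto intro!: integrable_lborel_translate)
    have j: "integrable lborel (\<lambda>x. norm (f (x + h n) + g (x + h n) - (f x + g x)))"
      using add.hyps integrable_lborel_translate[of "\<lambda>x. f x + g x" "h n"]
      by (intro integrable_norm Bochner_Integration.integrable_diff) auto
    show ?thesis
      unfolding Bochner_Integration.integral_add[OF i(1,2), symmetric]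
      by (rule integral_mono) (use i j in \<open>auto intro: norm_diff_triangle_ineq\<close>)
  qed
  ultimately show ?case
    by (rule_tac tendsto_sandwich[OF _ _ tendsto_const]) auto
next
  case (lim f s)
  \<comment> \<open>The factor 3 comes from \<open>norm (s i x) \<le> 2 * norm (f x)\<close>.\<close>
  have "(\<lambda>i. \<integral>x. norm (f x - s i x) \<partial>lborel) \<longlonglongrightarrow> (\<integral>x. 0 \<partial>(lborel :: 'a measure))"
  proof (rule integral_dominated_convergence[where w = "\<lambda>x. 3 * norm (f x)"])
    show "AE x in lborel. (\<lambda>i. norm (f x - s i x)) \<longlonglongrightarrow> 0"
    proof (rule AE_I2)
      fix x
      show "(\<lambda>i. norm (f x - s i x)) \<longlonglongrightarrow> 0"
        using tendsto_norm[OF tendsto_diff[OF tendsto_const lim(2), of x "f x"]] by simp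
    qed
    show "AE x in lborel. norm (norm (f x - s i x)) \<le> 3 * norm (f x)" for i
    proof (rule AE_I2)
      fix x
      have "norm (f x - s i x) \<le> norm (f x) + norm (s i x)" by (rule norm_triangle_ineq4)
      with lim(3)[of x i] show "norm (norm (f x - s i x)) \<le> 3 * norm (f x)" by simp
    qed
  qed (use lim(1,4) in \<open>auto intro!: borel_measurable_integrable\<close>)
  then have conv: "(\<lambda>i. \<integral>x. norm (f x - s i x) \<partial>lborel) \<longlonglongrightarrow> 0" by simp
  show ?case
  proof (rule translation_continuous_L1_approx[OF lim(4)])
    fix e :: real assume "0 < e"
    then obtain i where "(\<integral>x. norm (f x - s i x) \<partial>lborel) < e"
      using LIMSEQ_D[OF conv, of e] by auto
    then show "\<exists>g. integrable lborel g \<and> (\<integral>x. norm (f x - g x) \<partial>lborel) < e \<and>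
        (\<lambda>n. \<integral>x. norm (g (x + h n) - g x) \<partial>lborel) \<longlonglongrightarrow> 0"
      using lim(1) lim.IH by blast
  qed
qed

section \<open>The shift semigroup on \<open>L\<^sup>1(0,\<infinity>)\<close>\<close>

text \<open>
  Truncating the time at \<open>0\<close> makes the shift a total function that is continuous in \<open>t\<close> on the
  whole line, so that statements about limits need no sign conditions.
\<close>

lift_definition l1_shift :: "real \<Rightarrow> l1 \<Rightarrow> l1" is "\<lambda>t f x. f (x + max 0 t)"
  by (rule l1_eq_shift) auto

lemma l1_shift_0: "l1_shift 0 u = u"
  by transfer simp

lemma l1_shift_shift: "0 \<le> s \<Longrightarrow> 0 \<le> t \<Longrightarrow> l1_shift s (l1_shift t u) = l1_shift (s + t) u"
proof transfer
  fix s t :: real and f assume st: "0 \<le> s" "0 \<le> t" and f: "l1_eq f f"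
  have "(\<lambda>x. f (x + max 0 s + max 0 t)) = (\<lambda>x. f (x + max 0 (s + t)))"
    using st by (simp add: add.assoc)
  then show "l1_eq (\<lambda>x. f (x + max 0 s + max 0 t)) (\<lambda>x. f (x + max 0 (s + t)))"
    using l1_eq_shift[OF f, of "max 0 (s + t)"] by simp
qed

lemma l1_shift_scaleR: "l1_shift t (c *\<^sub>R u) = c *\<^sub>R l1_shift t u"
proof transfer
  fix t c :: real and f assume "l1_eq f f"
  then have "l1_eq (\<lambda>x. c * f x) (\<lambda>x. c * f x)"
    by (auto simp: l1_eq_def)
  from l1_eq_shift[OF this] show "l1_eq (\<lambda>x. c * f (x + max 0 t)) (\<lambda>x. c * f (x + max 0 t))"
    by simp
qed

lemma l1_shift_diff: "l1_shift t (u - v) = l1_shift t u - l1_shift t v"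
proof transfer
  fix t :: real and f g assume "l1_eq f f" "l1_eq g g"
  then have "l1_eq (\<lambda>x. f x - g x) (\<lambda>x. f x - g x)"
    by (auto simp: l1_eq_def)
  from l1_eq_shift[OF this] show "l1_eq (\<lambda>x. f (x + max 0 t) - g (x + max 0 t))
      (\<lambda>x. f (x + max 0 t) - g (x + max 0 t))"
    by simp
qed

lemma set_integral_shift:
  fixes f :: "real \<Rightarrow> real"
  shows "(LBINT x:{0<..}. f (x + t)) = (LBINT y:{t<..}. f y)"
proof -
  have "(\<integral>x. indicator {0<..} x *\<^sub>R f (x + t) \<partial>lborel)
      = (\<integral>x. indicator {t<..} (t + 1 * x) *\<^sub>R f (t + 1 * x) \<partial>lborel)"
    by (intro Bochner_Integration.integral_cong) (auto simp: add.commute indicator_def)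
  also have "\<dots> = (\<integral>y. indicator {t<..} y *\<^sub>R f y \<partial>lborel)"
    using lborel_integral_real_affine[of 1 "\<lambda>y. indicator {t<..} y *\<^sub>R f y" t] by simp
  finally show ?thesis
    by (simp add: set_lebesgue_integral_def)
qed

lemma norm_l1_shift_le: "norm (l1_shift t u) \<le> norm u"
proof transfer
  fix t :: real and f assume "l1_eq f f"
  then have i: "set_integrable lborel {0<..} (\<lambda>x. \<bar>f x\<bar>)"
    by (auto simp: l1_eq_def intro: set_integrable_abs)
  have "(LBINT x:{0<..}. \<bar>f (x + max 0 t)\<bar>) = (LBINT y:{max 0 t<..}. \<bar>f y\<bar>)"
    by (rule set_integral_shift)
  also have "\<dots> \<le> (LBINT y:{0<..}. \<bar>f y\<bar>)"
    using i unfolding set_lebesgue_integral_def set_integrable_def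
    by (rule integral_mono') (auto simp: indicator_def)
  finally show "(LBINT x:{0<..}. \<bar>f (x + max 0 t)\<bar>) \<le> (LBINT x:{0<..}. \<bar>f x\<bar>)" .
qed

text \<open>
  Nonnegativity means that \<open>f\<close> and its absolute value are in the same class, and the shift respects
  classes.
\<close>

lemma AE_nonneg_shift:
  assumes "AE x\<in>{0<..} in lborel. 0 \<le> f x" and f: "set_integrable lborel {0<..} f" and t: "0 \<le> (t :: real)"
  shows "AE x\<in>{0<..} in lborel. 0 \<le> (f (x + t) :: real)"
proof -
  have "l1_eq f (\<lambda>x. \<bar>f x\<bar>)"
    using assms by (auto simp: l1_eq_def intro: set_integrable_abs elim!: eventually_mono)
  from l1_eq_shift[OF this t] show ?thesis
    by (auto simp: l1_eq_def elim!: eventually_mono)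
qed

lemma l1_shift_nonneg: "u \<in> L1_plus \<Longrightarrow> l1_shift t u \<in> L1_plus"
  unfolding L1_plus_def mem_Collect_eq
  by transfer (rule AE_nonneg_shift, auto simp: l1_eq_def)

lemma scaleR_nonneg: "u \<in> L1_plus \<Longrightarrow> 0 \<le> c \<Longrightarrow> c *\<^sub>R u \<in> L1_plus"
  unfolding L1_plus_def mem_Collect_eq
  by transfer (auto elim!: eventually_mono)

text \<open>
  Extended by \<open>0\<close> to the line, \<open>f\<close> is integrable there. For \<open>s, t \<ge> 0\<close> its translates by
  \<open>s\<close> and \<open>t\<close> agree on \<open>(0, \<infinity>)\<close> with the shifts of \<open>f\<close>, so continuity of translation applies
  to the increment \<open>t - s\<close>.
\<close>

lemma l1_shift_tendsto:
  assumes "t \<longlonglongrightarrow> a"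
  shows "(\<lambda>n. l1_shift (t n) u) \<longlonglongrightarrow> l1_shift a u"
proof -
  have "(\<lambda>n. norm (l1_shift (t n) u - l1_shift a u)) \<longlonglongrightarrow> 0"
    using assms
  proof transfer
    fix t :: "nat \<Rightarrow> real" and a :: real and f
    assume t: "t \<longlonglongrightarrow> a" and f: "l1_eq f f"
    define g where "g = (\<lambda>x. indicator {0<..} x *\<^sub>R f x)"
    define h where "h = (\<lambda>n. max 0 (t n) - max 0 a)"
    have g: "integrable lborel g"
      using l1_eq_integrable(1)[OF f] by (simp add: g_def set_integrable_def)
    have h: "h \<longlonglongrightarrow> 0"
      unfolding h_def by (rule tendsto_eq_intros t refl | simp)+
    have "(LBINT x:{0<..}. \<bar>f (x + max 0 (t n)) - f (x + max 0 a)\<bar>)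
        \<le> (\<integral>x. norm (g (x + h n) - g x) \<partial>lborel)" for n
    proof -
      have i: "integrable lborel (\<lambda>x. norm (g (x + h n) - g x))"
        using g by (intro integrable_norm Bochner_Integration.integrable_diff integrable_lborel_translate)
      have j: "integrable lborel (\<lambda>x. norm (g (x + max 0 (t n)) - g (x + max 0 a)))"
        using integrable_lborel_translate[OF i, of "max 0 a"] by (simp add: h_def)
      have "(LBINT x:{0<..}. \<bar>f (x + max 0 (t n)) - f (x + max 0 a)\<bar>)
          \<le> (\<integral>x. norm (g (x + max 0 (t n)) - g (x + max 0 a)) \<partial>lborel)"
        unfolding set_lebesgue_integral_def
        by (rule integral_mono'[OF j]) (auto simp: g_def indicator_def)
      also have "\<dots> = (\<integral>x. norm (g (x + h n) - g x) \<partial>lborel)"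
        using integral_lborel_translate[OF i, of "max 0 a"] by (simp add: h_def)
      finally show ?thesis .
    qed
    then show "(\<lambda>n. LBINT x:{0<..}. \<bar>f (x + max 0 (t n)) - f (x + max 0 a)\<bar>) \<longlonglongrightarrow> 0"
      by (intro tendsto_sandwich[OF _ _ tendsto_const translation_continuous_L1[OF g h]] always_eventually allI)
        (auto simp: set_lebesgue_integral_def intro!: Bochner_Integration.integral_nonneg)
  qed
  then show ?thesis
    by (rule LIM_zero_cancel[OF tendsto_norm_zero_cancel])
qed

text \<open>
  The shifts are contractions, so strong continuity upgrades to joint continuity.
\<close>

lemma l1_shift_tendsto2:
  assumes t: "t \<longlonglongrightarrow> a" and v: "v \<longlonglongrightarrow> u"
  shows "(\<lambda>n. l1_shift (t n) (v n)) \<longlonglongrightarrow> l1_shift a u"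
proof -
  have "(\<lambda>n. norm (v n - u)) \<longlonglongrightarrow> 0"
    using v by (simp add: LIM_zero tendsto_norm_zero)
  then have "(\<lambda>n. l1_shift (t n) (v n - u)) \<longlonglongrightarrow> 0"
    by (rule Lim_null_comparison[rotated]) (simp add: norm_l1_shift_le)
  from tendsto_add[OF this l1_shift_tendsto[OF t, of u]] show ?thesis
    by (simp add: l1_shift_diff)
qed

section \<open>The flow as a normalised shift\<close>

text \<open>
  On the positive cone the masses in \<open>rho\<close> are norms. This identity removes representatives
  from all that follows.
\<close>

theorem flow_eq_shift:
  assumes t: "0 \<le> t" and u: "u \<in> L1_plus"
  shows "flow t u = (norm (l1_shift t u) / norm u) *\<^sub>R l1_shift t u"
  using u unfolding L1_plus_def mem_Collect_eq using t
proof transfer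
  fix t :: real and f
  assume t: "0 \<le> t" and f: "l1_eq f f" and pos: "AE x\<in>{0<..} in lborel. 0 \<le> f x"
  have i: "set_integrable lborel {0<..} f" using f by (rule l1_eq_integrable)
  have abs: "l1_eq (\<lambda>x. \<bar>f x\<bar>) f"
    using i pos by (auto simp: l1_eq_def intro: set_integrable_abs elim!: eventually_mono)
  have "(LBINT x:{0<..}. \<bar>f (x + t)\<bar>) = (LBINT y:{t<..}. \<bar>f y\<bar>)"
    by (rule set_integral_shift)
  also have "\<dots> = (LBINT y:{t<..}. f y)"
    using t by (intro l1_eq_set_integral[OF abs]) auto
  finally have "rho f t = (LBINT x:{0<..}. \<bar>f (x + t)\<bar>) / (LBINT x:{0<..}. \<bar>f x\<bar>)"
    unfolding rho_def by (simp add: l1_eq_set_integral[OF abs])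
  then have "(\<lambda>x. sol_formula f x t)
      = (\<lambda>x. (LBINT x:{0<..}. \<bar>f (x + max 0 t)\<bar>) / (LBINT x:{0<..}. \<bar>f x\<bar>) * f (x + max 0 t))"
    using t by (simp add: sol_formula_def max_def)
  moreover have "l1_eq (\<lambda>x. c * f (x + max 0 t)) (\<lambda>x. c * f (x + max 0 t))" for c
    using l1_eq_shift[OF f, of "max 0 t"] by (auto simp: l1_eq_def)
  ultimately show "l1_eq (if 0 \<le> t then (\<lambda>x. sol_formula f x t) else (\<lambda>_. 0))
      (\<lambda>x. (LBINT x:{0<..}. \<bar>f (x + max 0 t)\<bar>) / (LBINT x:{0<..}. \<bar>f x\<bar>) * f (x + max 0 t))"
    by (simp only: t if_True)
qed

lemma norm_flow_le:
  assumes "0 \<le> t" "u \<in> L1_plus"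
  shows "norm (flow t u) \<le> norm u"
proof -
  have "norm (l1_shift t u) / norm u \<le> 1"
    using norm_l1_shift_le[of t u] by (simp add: divide_le_eq_1)
  then have "norm (l1_shift t u) / norm u * norm (l1_shift t u) \<le> 1 * norm u"
    by (intro mult_mono norm_l1_shift_le) auto
  then show ?thesis
    using assms by (simp add: flow_eq_shift)
qed

text \<open>
  The factor \<open>norm (l1_shift t u) / norm u\<close> has no limit at \<open>u = 0\<close> but stays in \<open>[0, 1]\<close>, so the
  origin is treated by the bound on the norm.
\<close>

lemma continuous_on_flow: "continuous_on ({0..} \<times> L1_plus) (\<lambda>(t, u). flow t u)"
  unfolding continuous_on_sequentially
proof (intro allI ballI impI, elim conjE)
  fix z :: "nat \<Rightarrow> real \<times> l1" and p assume p: "p \<in> {0..} \<times> L1_plus" and z: "\<forall>n. z n \<in> {0..} \<times> L1_plus" "z \<longlonglongrightarrow> p"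
  define t v a u where "t = (\<lambda>n::nat. fst (z n))" and "v = (\<lambda>n. snd (z n))" and "a = fst p" and "u = snd p"
  have a: "0 \<le> a" "u \<in> L1_plus" and tv: "0 \<le> t n" "v n \<in> L1_plus" for n
    using p z(1) by (auto simp: a_def u_def t_def v_def mem_Times_iff)
  have t: "t \<longlonglongrightarrow> a" and v: "v \<longlonglongrightarrow> u"
    using z(2) by (auto simp: a_def u_def t_def v_def intro: tendsto_fst tendsto_snd)
  have "(\<lambda>n. flow (t n) (v n)) \<longlonglongrightarrow> flow a u"
  proof (cases "u = 0")
    case True
    have "(\<lambda>n. norm (v n)) \<longlonglongrightarrow> 0"
      using tendsto_norm[OF v] True by simp
    then have "(\<lambda>n. flow (t n) (v n)) \<longlonglongrightarrow> 0"
      by (rule Lim_null_comparison[rotated]) (simp add: norm_flow_le tv)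
    moreover have "flow a u = 0"
      using norm_flow_le[OF a] True by simp
    ultimately show ?thesis by simp
  next
    case False
    then show ?thesis
      unfolding flow_eq_shift[OF a] flow_eq_shift[OF tv]
      by (intro tendsto_scaleR tendsto_divide tendsto_norm l1_shift_tendsto2 t v) simp
  qed
  then show "((\<lambda>(t, u). flow t u) \<circ> z) \<longlonglongrightarrow> (case p of (t, u) \<Rightarrow> flow t u)"
    by (simp add: o_def case_prod_beta t_def v_def a_def u_def)
qed

lemma flow_in_L1_plus: "0 \<le> t \<Longrightarrow> u \<in> L1_plus \<Longrightarrow> flow t u \<in> L1_plus"
  by (simp add: flow_eq_shift scaleR_nonneg l1_shift_nonneg)

text \<open>
  The normalising factor for time \<open>s\<close>, computed at \<open>flow t u\<close>, does not see the factor \<open>c\<close> that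
  \<open>flow t u\<close> carries, so the two quotients telescope. If \<open>u\<close> or its shift by \<open>t\<close> vanishes, then
  so does the shift by \<open>s + t\<close>, and both sides are \<open>0\<close>.
\<close>

lemma flow_flow:
  assumes "0 \<le> s" "0 \<le> t" "u \<in> L1_plus"
  shows "flow (s + t) u = flow s (flow t u)"
proof -
  define c where "c = norm (l1_shift t u) / norm u"
  have c: "0 \<le> c" by (simp add: c_def)
  have st: "norm (l1_shift (s + t) u) \<le> norm (l1_shift t u)"
    using norm_l1_shift_le[of s "l1_shift t u"] assms by (simp add: l1_shift_shift)
  have ft: "flow t u = c *\<^sub>R l1_shift t u"
    unfolding c_def by (rule flow_eq_shift[OF assms(2,3)])
  have "flow s (flow t u) = (norm (l1_shift s (flow t u)) / norm (flow t u)) *\<^sub>R l1_shift s (flow t u)"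
    using assms by (intro flow_eq_shift flow_in_L1_plus)
  also have "\<dots> = (norm (c *\<^sub>R l1_shift (s + t) u) / norm (c *\<^sub>R l1_shift t u)) *\<^sub>R c *\<^sub>R l1_shift (s + t) u"
    unfolding ft l1_shift_scaleR l1_shift_shift[OF assms(1,2)] ..
  also have "\<dots> = (norm (l1_shift (s + t) u) / norm u) *\<^sub>R l1_shift (s + t) u"
    using st by (cases "norm u = 0 \<or> norm (l1_shift t u) = 0") (auto simp: c_def)
  finally show ?thesis
    using assms by (simp add: flow_eq_shift)
qed

theorem flow_dynamical_system: "continuous_dynamical_system_on L1_plus flow"
  unfolding continuous_dynamical_system_on_def
proof (intro conjI allI ballI impI continuous_on_flow flow_in_L1_plus flow_flow)
  show "flow 0 u = u" if "u \<in> L1_plus" for u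
    using flow_eq_shift[OF order.refl that] by (simp add: l1_shift_0)
qed

section \<open>The tail mass and the solution formula\<close>

definition tail_mass :: "(real \<Rightarrow> real) \<Rightarrow> real \<Rightarrow> real" where
  "tail_mass f t = (LBINT y:{t<..}. f y)"

lemma rho_eq_tail_mass: "rho f t = tail_mass f t / tail_mass f 0"
  by (simp add: rho_def tail_mass_def)

text \<open>
  A linear map of the line is multiplication by its value at \<open>1\<close>.
\<close>

lemma C1_on_real_derivative:
  fixes f :: "real \<Rightarrow> real"
  assumes "C1_on S f"
  obtains d where "\<And>x. x \<in> S \<Longrightarrow> (f has_real_derivative d x) (at x within S)" "continuous_on S d"
proof -
  obtain f' where f': "\<forall>x\<in>S. (f has_derivative blinfun_apply (f' x)) (at x within S)"
    and cont: "continuous_on S f'"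
    using assms by (auto simp: C1_on_def)
  have "blinfun_apply (f' x) z = blinfun_apply (f' x) 1 * z" for x z
    using blinfun.scaleR_right[of "f' x" z 1] by simp
  then have "blinfun_apply (f' x) = (*) (blinfun_apply (f' x) 1)" for x
    by (rule ext)
  then have "(f has_real_derivative blinfun_apply (f' x) 1) (at x within S)" if "x \<in> S" for x
    using bspec[OF f' that] by (simp add: has_field_derivative_def)
  moreover have "continuous_on S (\<lambda>x. blinfun_apply (f' x) 1)"
    by (intro continuous_intros cont)
  ultimately show ?thesis by (rule that)
qed

locale kinetic_datum =
  fixes f0 :: "real \<Rightarrow> real"
  assumes integrable: "set_integrable lborel {0<..} f0"
    and nonneg: "\<And>x. 0 \<le> x \<Longrightarrow> 0 \<le> f0 x"
    and continuous: "continuous_on {0..} f0"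
begin

lemma tail_mass_nonneg: "0 \<le> t \<Longrightarrow> 0 \<le> tail_mass f0 t"
  unfolding tail_mass_def set_lebesgue_integral_def
  by (intro Bochner_Integration.integral_nonneg) (auto simp: indicator_def nonneg)

lemma tail_mass_eq: assumes "0 \<le> t" shows "tail_mass f0 t = tail_mass f0 0 - integral {0..t} f0"
proof -
  have i: "set_integrable lborel {0<..t} f0" "set_integrable lborel {t<..} f0"
    by (rule set_integrable_subset[OF integrable]; use assms in auto)+
  have "tail_mass f0 0 = (LBINT y:{0<..t} \<union> {t<..}. f0 y)"
    using assms by (simp add: tail_mass_def ivl_disj_un)
  also have "\<dots> = (LBINT y:{0<..t}. f0 y) + tail_mass f0 t"
    unfolding tail_mass_def by (rule set_integral_Un[OF _ i]) auto
  also have "(LBINT y:{0<..t}. f0 y) = integral {0<..t} f0"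
    by (rule set_borel_integral_eq_integral(2)[OF i(1)])
  also have "\<dots> = integral {0..t} f0"
    by (rule integral_subset_negligible) (auto intro: negligible_subset[of "{0}"])
  finally show ?thesis by simp
qed

lemma tail_mass_antimono:
  assumes "0 \<le> s" "s \<le> t" shows "tail_mass f0 t \<le> tail_mass f0 s"
proof -
  have c: "continuous_on {0..t} f0" "continuous_on {0..s} f0"
    by (rule continuous_on_subset[OF continuous]; auto)+
  have "integral {0..s} f0 \<le> integral {0..t} f0"
    using assms by (intro integral_subset_le integrable_continuous_interval c) (auto simp: nonneg)
  then show ?thesis
    using assms tail_mass_eq[of s] tail_mass_eq[of t] by simp
qed

lemma tail_mass_has_derivative:
  assumes t: "0 \<le> t"
  shows "(tail_mass f0 has_real_derivative - f0 t) (at t within {0..})"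
proof -
  have c: "continuous_on {0..t+1} f0"
    by (rule continuous_on_subset[OF continuous]) auto
  have "((\<lambda>s. integral {0..s} f0) has_real_derivative f0 t) (at t within {0..t+1})"
    using t by (intro integral_has_real_derivative c) auto
  then have "((\<lambda>s. tail_mass f0 0 - integral {0..s} f0) has_real_derivative 0 - f0 t) (at t within {0..t+1})"
    by (intro DERIV_diff DERIV_const)
  moreover have "at t within {0..t+1} = at t within {0..}"
    by (rule at_within_nhd[of _ "{..<t+1}"]) auto
  ultimately have "((\<lambda>s. tail_mass f0 0 - integral {0..s} f0) has_real_derivative - f0 t) (at t within {0..})"
    by simp
  then show ?thesis
    by (rule has_field_derivative_transform_within[OF _ zero_less_one]) (use t in \<open>auto simp: tail_mass_eq[symmetric]\<close>)
qed

text \<open>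
  If the tail mass vanished at \<open>s \<le> y\<close>, it would vanish on \<open>[y, \<infinity>)\<close> by monotonicity, and its
  right derivative \<open>- f0 y\<close> would be \<open>0\<close>. The case \<open>s = y\<close> is included so that a vanishing tail
  also forces the boundary value \<open>f0 s = 0\<close>.
\<close>

lemma tail_mass_pos:
  assumes s: "0 \<le> s" "s \<le> y" and y: "f0 y > 0"
  shows "tail_mass f0 s > 0"
proof (rule ccontr)
  assume "\<not> tail_mass f0 s > 0"
  then have zero: "tail_mass f0 r = 0" if "y \<le> r" for r
    using tail_mass_antimono[of s r] tail_mass_nonneg[of r] that s by linarith
  have "(tail_mass f0 has_real_derivative - f0 y) (at y within {y..})"
    by (rule DERIV_subset[OF tail_mass_has_derivative]) (use s in auto)
  moreover have "(tail_mass f0 has_real_derivative 0) (at y within {y..})"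
    by (rule has_field_derivative_transform_within[OF DERIV_const[of 0] zero_less_one]) (auto simp: zero)
  ultimately have "- f0 y = 0"
    by (rule has_field_derivative_unique) (simp add: at_within_Ici_at_right)
  with y show False by simp
qed

lemma zero_beyond_tail_mass_zero: "0 \<le> s \<Longrightarrow> s \<le> y \<Longrightarrow> tail_mass f0 s = 0 \<Longrightarrow> f0 y = 0"
  using tail_mass_pos[of s y] nonneg[of y] by fastforce

lemma rho_has_derivative:
  assumes t: "0 \<le> t"
  shows "(rho f0 has_real_derivative - f0 t / tail_mass f0 0) (at t within {0..})"
  unfolding rho_eq_tail_mass[abs_def] by (rule DERIV_cdivide[OF tail_mass_has_derivative[OF t]])

lemma mass_sol_formula: "mass (sol_formula f0) t = rho f0 t * tail_mass f0 t"
  using set_integral_shift[of f0 t] by (simp add: mass_def sol_formula_def tail_mass_def)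

text \<open>
  One-sided derivatives on the closed quadrant: both factors are composed with linear maps into
  the half-line, and the product rule gives the derivative \<open>D\<close> in operator form.
\<close>

lemma C1_on_sol_formula:
  assumes "C1_on {0..} f0"
  shows "C1_on ({0..} \<times> {0..}) (\<lambda>(x, t). sol_formula f0 x t)"
proof -
  obtain d where d: "\<And>x. x \<in> {0..} \<Longrightarrow> (f0 has_real_derivative d x) (at x within {0..})"
    and d_cont: "continuous_on {0..} d"
    using C1_on_real_derivative[OF assms] by blast
  let ?Q = "{0..} \<times> {0..} :: (real \<times> real) set"
  define D :: "real \<times> real \<Rightarrow> (real \<times> real) \<Rightarrow>\<^sub>L real" where
    "D = (\<lambda>p. (- f0 (snd p) / tail_mass f0 0 * f0 (fst p + snd p)) *\<^sub>R snd_blinfun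
        + (rho f0 (snd p) * d (fst p + snd p)) *\<^sub>R (fst_blinfun + snd_blinfun))"
  have img: "(\<lambda>p. fst p + snd p) ` ?Q \<subseteq> {0..}" "snd ` ?Q \<subseteq> {0..}"
    by auto
  have rho_cont: "continuous_on {0..} (rho f0)"
    by (rule DERIV_continuous_on[OF rho_has_derivative]) simp
  have args: "continuous_on ?Q (\<lambda>p. fst p + snd p)" "continuous_on ?Q snd"
    by (intro continuous_intros)+
  note coeff = continuous_on_compose2[OF continuous args(2) img(2)]
    continuous_on_compose2[OF rho_cont args(2) img(2)]
    continuous_on_compose2[OF continuous args(1) img(1)]
    continuous_on_compose2[OF d_cont args(1) img(1)]
  have "continuous_on ?Q D"
    unfolding D_def divide_inverse by (intro continuous_intros coeff)
  moreover have "((\<lambda>(x, t). sol_formula f0 x t) has_derivative blinfun_apply (D p)) (at p within ?Q)"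
    if p: "p \<in> ?Q" for p
  proof -
    have 1: "((\<lambda>p. f0 (fst p + snd p)) has_derivative (\<lambda>q. d (fst p + snd p) * (fst q + snd q))) (at p within ?Q)"
      by (rule has_derivative_in_compose2[OF d[unfolded has_field_derivative_def] img(1) p])
        (auto intro!: derivative_eq_intros)
    have 2: "((\<lambda>p. rho f0 (snd p)) has_derivative (\<lambda>q. - f0 (snd p) / tail_mass f0 0 * snd q)) (at p within ?Q)"
      by (rule has_derivative_in_compose2[OF rho_has_derivative[unfolded has_field_derivative_def] img(2) p])
        (auto intro!: derivative_eq_intros)
    have "((\<lambda>p. rho f0 (snd p) * f0 (fst p + snd p)) has_derivative blinfun_apply (D p)) (at p within ?Q)"
      by (rule has_derivative_eq_rhs[OF has_derivative_mult[OF 2 1]])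
        (simp add: D_def fun_eq_iff blinfun.bilinear_simps algebra_simps snd_blinfun.rep_eq)
    then show ?thesis
      by (simp add: sol_formula_def case_prod_unfold)
  qed
  ultimately show ?thesis
    unfolding C1_on_def by (intro exI[of _ D] conjI ballI)
qed

lemma sol_formula_integrable:
  assumes t: "0 \<le> t" shows "set_integrable lborel {0<..} (\<lambda>x. sol_formula f0 x t)"
proof -
  have "l1_eq f0 f0" using integrable by (simp add: l1_eq_def)
  from l1_eq_integrable(1)[OF l1_eq_shift[OF this t]] show ?thesis
    by (simp add: sol_formula_def)
qed

lemma sol_formula_0: "0 \<le> x \<Longrightarrow> sol_formula f0 x 0 = f0 x"
  using zero_beyond_tail_mass_zero[of 0 x] by (simp add: sol_formula_def rho_eq_tail_mass)

text \<open>
  The transport operator differentiates only \<open>rho\<close>, since \<open>f0 (x + t)\<close> is constant along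
  characteristics. With \<open>F = tail_mass f0\<close>, what remains is the identity of rates
  \<open>f0 t / F t * rho f0 t = f0 t / F 0\<close>. If \<open>F t = 0\<close>, it is replaced by \<open>f0 (x + t) = 0\<close>.
\<close>

lemma sol_formula_equation:
  assumes d: "\<And>x. 0 < x \<Longrightarrow> (f0 has_real_derivative d x) (at x)" and x: "0 < x" and t: "0 < t"
  shows "deriv (\<lambda>s. sol_formula f0 x s) t - deriv (\<lambda>y. sol_formula f0 y t) x
      = - (sol_formula f0 0 t / mass (sol_formula f0) t) * sol_formula f0 x t"
proof -
  have "((\<lambda>s. f0 (x + s)) has_real_derivative d (x + t) * 1) (at t)"
    by (rule DERIV_chain2[OF d]) (use x t in \<open>auto intro!: derivative_eq_intros\<close>)
  moreover have "((\<lambda>y. f0 (y + t)) has_real_derivative d (x + t) * 1) (at x)"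
    by (rule DERIV_chain2[OF d]) (use x t in \<open>auto intro!: derivative_eq_intros\<close>)
  ultimately have f0: "((\<lambda>s. f0 (x + s)) has_real_derivative d (x + t)) (at t)"
    "((\<lambda>y. f0 (y + t)) has_real_derivative d (x + t)) (at x)"
    by simp_all
  have rho: "(rho f0 has_real_derivative - f0 t / tail_mass f0 0) (at t)"
    using rho_has_derivative[of t] t at_within_interior[of t "{0..}"] by simp
  have "deriv (\<lambda>s. sol_formula f0 x s) t = - f0 t / tail_mass f0 0 * f0 (x + t) + rho f0 t * d (x + t)"
    unfolding sol_formula_def
    by (rule DERIV_imp_deriv[OF DERIV_cong[OF DERIV_mult[OF rho f0(1)]]]) simp
  moreover have "deriv (\<lambda>y. sol_formula f0 y t) x = rho f0 t * d (x + t)"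
    unfolding sol_formula_def by (rule DERIV_imp_deriv[OF DERIV_cmult[OF f0(2)]])
  moreover have "f0 t / tail_mass f0 0 * f0 (x + t) = sol_formula f0 0 t / mass (sol_formula f0) t * sol_formula f0 x t"
    using zero_beyond_tail_mass_zero[of t "x + t"] x t
    by (cases "tail_mass f0 t = 0") (auto simp: mass_sol_formula sol_formula_def rho_eq_tail_mass)
  ultimately show ?thesis by simp
qed

end

lemma C1_on_imp_continuous_on: "C1_on S f \<Longrightarrow> continuous_on S f"
  unfolding C1_on_def by (elim exE conjE, rule has_derivative_continuous_on) blast

theorem (in kinetic_datum) sol_formula_classical_solution:
  assumes C1: "C1_on {0..} f0"
  shows "classical_solution f0 (sol_formula f0)"
  unfolding classical_solution_def
proof (intro conjI allI impI)
  obtain d where within: "\<And>x. x \<in> {0..} \<Longrightarrow> (f0 has_real_derivative d x) (at x within {0..})"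
    using C1_on_real_derivative[OF C1] by blast
  have d: "(f0 has_real_derivative d x) (at x)" if "0 < x" for x
    using within[of x] that at_within_interior[of x "{0..}"] by simp
  fix x t :: real assume "0 < x" "0 < t"
  then show "deriv (\<lambda>s. sol_formula f0 x s) t - deriv (\<lambda>y. sol_formula f0 y t) x
      = - (sol_formula f0 0 t / mass (sol_formula f0) t) * sol_formula f0 x t"
    by (rule sol_formula_equation[of d, rotated]) (rule d)
next
  fix x t :: real assume "0 \<le> x" "0 \<le> t"
  then show "0 \<le> sol_formula f0 x t"
    unfolding sol_formula_def rho_eq_tail_mass
    by (intro mult_nonneg_nonneg divide_nonneg_nonneg tail_mass_nonneg nonneg) simp_all
qed (simp_all add: C1_on_sol_formula C1 sol_formula_integrable sol_formula_0)

section \<open>Uniqueness along characteristics\<close>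

lemma C1_on_interior_differentiable:
  assumes "C1_on S f" "x \<in> interior S"
  shows "f differentiable at x"
  using assms at_within_interior[OF assms(2)] interior_subset[of S]
  unfolding C1_on_def differentiable_def by (metis subsetD)

text \<open>
  The chain rule on the line \<open>r \<mapsto> (y - r, r)\<close>, with the directional derivative split into the
  two partial derivatives.
\<close>

lemma DERIV_along_characteristic:
  fixes f :: "real \<Rightarrow> real \<Rightarrow> real"
  assumes "(\<lambda>(x, t). f x t) differentiable at (y - s, s)"
  shows "((\<lambda>r. f (y - r) r) has_real_derivative deriv (\<lambda>r. f (y - s) r) s - deriv (\<lambda>x. f x s) (y - s)) (at s)"
proof -
  obtain D where D: "((\<lambda>(x, t). f x t) has_derivative D) (at (y - s, s))"
    using assms by (auto simp: differentiable_def)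
  interpret bounded_linear D using D by (rule has_derivative_bounded_linear)
  \<comment> \<open>The three derivatives are one chain rule along lines of direction \<open>(a, b)\<close>.\<close>
  have line: "((\<lambda>r. f (fst (g r)) (snd (g r))) has_real_derivative D (a, b)) (at r0)"
    if g: "(g has_derivative (\<lambda>h. (h * a, h * b))) (at r0)" "g r0 = (y - s, s)" for g r0 a b
  proof -
    have "(((\<lambda>(x, t). f x t) \<circ> g) has_derivative (D \<circ> (\<lambda>h. (h * a, h * b)))) (at r0)"
      by (rule diff_chain_at[OF g(1)]) (simp add: g(2) D)
    moreover have "D \<circ> (\<lambda>h. (h * a, h * b)) = (*) (D (a, b))"
      using scaleR[of _ "(a, b)"] by (simp add: fun_eq_iff mult.commute)
    ultimately show ?thesis
      by (simp add: has_field_derivative_def o_def case_prod_beta)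
  qed
  have t: "((\<lambda>r. f (y - s) r) has_real_derivative D (0, 1)) (at s)"
  proof -
    have "((\<lambda>r. (y - s, r)) has_derivative (\<lambda>h. (h * 0, h * 1))) (at (s))"
      by (rule has_derivative_Pair) (auto intro!: derivative_eq_intros)
    from line[OF this] show ?thesis by simp
  qed
  have x: "((\<lambda>x. f x s) has_real_derivative D (1, 0)) (at (y - s))"
  proof -
    have "((\<lambda>x. (x, s)) has_derivative (\<lambda>h. (h * 1, h * 0))) (at (y - s))"
      by (rule has_derivative_Pair) (auto intro!: derivative_eq_intros)
    from line[OF this] show ?thesis by simp
  qed
  have "((\<lambda>r. f (y - r) r) has_real_derivative D (-1, 1)) (at s)"
  proof -
    have "((\<lambda>r. (y - r, r)) has_derivative (\<lambda>h. (h * - 1, h * 1))) (at (s))"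
      by (rule has_derivative_Pair) (auto intro!: derivative_eq_intros)
    from line[OF this] show ?thesis by simp
  qed
  also have "D (-1, 1) = D (0, 1) - D (1, 0)"
    using diff[of "(0, 1)" "(1, 0)"] by simp
  finally show ?thesis
    using DERIV_imp_deriv[OF t] DERIV_imp_deriv[OF x] by simp
qed

locale kinetic_solution = kinetic_datum +
  fixes f :: "real \<Rightarrow> real \<Rightarrow> real"
  assumes solution: "classical_solution f0 f"
begin

lemma f_nonneg: "0 \<le> x \<Longrightarrow> 0 \<le> t \<Longrightarrow> 0 \<le> f x t"
  using solution by (simp add: classical_solution_def)

lemma f_initial: "0 \<le> x \<Longrightarrow> f x 0 = f0 x"
  using solution by (simp add: classical_solution_def)

lemma f_continuous: "continuous_on ({0..} \<times> {0..}) (\<lambda>(x, t). f x t)"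
  using solution by (auto simp: classical_solution_def intro: C1_on_imp_continuous_on)

text \<open>
  The solution in the moving frame of the transport operator: \<open>y\<close> labels the characteristic by its
  starting point, and it leaves the half-line at time \<open>s = y\<close>.
\<close>

definition along :: "real \<Rightarrow> real \<Rightarrow> real" where "along y s = f (y - s) s"

lemma along_nonneg: "0 \<le> s \<Longrightarrow> s \<le> y \<Longrightarrow> 0 \<le> along y s"
  by (simp add: along_def f_nonneg)

lemma along_0: "0 \<le> y \<Longrightarrow> along y 0 = f0 y"
  by (simp add: along_def f_initial)

lemma along_continuous:
  assumes "s \<le> y" shows "continuous_on {0..s} (along y)"
proof -
  have "continuous_on {0..s} (\<lambda>r. (y - r, r))"
    by (intro continuous_intros)
  moreover have "(\<lambda>r. (y - r, r)) ` {0..s} \<subseteq> {0..} \<times> {0..}"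
    using assms by auto
  ultimately show ?thesis
    using continuous_on_compose2[OF f_continuous] by (fastforce simp: along_def[abs_def])
qed

text \<open>
  The kinetic equation in characteristic form; the rate does not depend on \<open>y\<close>.
\<close>

lemma along_derivative:
  assumes "0 < s" "s < y"
  shows "(along y has_real_derivative - (f 0 s / mass f s) * along y s) (at s)"
proof -
  have "(y - s, s) \<in> interior ({0..} \<times> {0..})"
    using assms by (simp add: interior_Times)
  then have "(\<lambda>(x, t). f x t) differentiable at (y - s, s)"
    using solution by (intro C1_on_interior_differentiable) (auto simp: classical_solution_def)
  from DERIV_along_characteristic[OF this] show ?thesis
    using solution assms by (simp add: classical_solution_def along_def[abs_def])
qed

lemma along_le: assumes "0 \<le> s" "s \<le> y" shows "along y s \<le> f0 y"
proof -
  have "along y s \<le> along y 0"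
  proof (rule DERIV_nonpos_imp_decreasing_open[OF assms(1) _ along_continuous[OF assms(2)]])
    fix r assume r: "0 < r" "r < s"
    have "0 \<le> mass f r"
      using r f_nonneg by (auto simp: mass_def set_lebesgue_integral_def indicator_def intro!: Bochner_Integration.integral_nonneg)
    then have "0 \<le> f 0 r / mass f r * along y r"
      using r assms f_nonneg[of 0 r] along_nonneg[of r y] by simp
    then show "\<exists>z. (along y has_real_derivative z) (at r) \<and> z \<le> 0"
      using along_derivative[of r y] r assms by (intro exI[of _ "- (f 0 r / mass f r) * along y r"]) auto
  qed
  then show ?thesis using along_0[of y] assms by simp
qed

text \<open>
  Two solutions of the same linear homogeneous equation have a constant ratio. Positivity of
  \<open>along y\<close> keeps the quotient defined.
\<close>

lemma along_proportional:
  assumes s: "0 \<le> s" "s \<le> y" "s \<le> z" and pos: "\<And>r. 0 \<le> r \<Longrightarrow> r \<le> s \<Longrightarrow> along y r > 0"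
  shows "along z s = along y s / f0 y * f0 z"
proof -
  have "along z s / along y s = along z 0 / along y 0"
  proof (cases "s = 0")
    case False
    then have "0 < s" using s by simp
    then show ?thesis
    proof (rule DERIV_isconst_end)
      show "continuous_on {0..s} (\<lambda>r. along z r / along y r)"
        using pos s by (intro continuous_intros along_continuous) (auto simp: less_imp_neq[symmetric])
      fix r assume r: "0 < r" "r < s"
      let ?a = "f 0 r / mass f r"
      have "((\<lambda>r. along z r / along y r) has_real_derivative
          ((- ?a * along z r) * along y r - along z r * (- ?a * along y r)) / (along y r * along y r)) (at r)"
        using r s pos[of r] by (intro DERIV_divide along_derivative) auto
      then show "((\<lambda>r. along z r / along y r) has_real_derivative 0) (at r)"
        by simp
    qed
  qed simp
  then show ?thesis
    using pos[of s] s along_0[of y] along_0[of z] by (simp add: field_simps)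
qed

text \<open>
  By proportionality \<open>f x r = c * f0 (x + r)\<close> for all \<open>x \<ge> 0\<close>, with \<open>c > 0\<close>. This determines the
  rate as \<open>f0 r / F r\<close> with \<open>F = tail_mass f0\<close>, which is also the decay rate of \<open>F\<close>; so
  \<open>along y / F\<close> is constant on \<open>[0, s)\<close>. Positivity is assumed only before \<open>s\<close>, and continuity yields the value at
  \<open>s\<close> itself, which allows the lemma to be applied at a first zero.
\<close>

lemma along_eq_while_positive:
  assumes s: "0 \<le> s" "s < y" and y: "f0 y > 0" and pos: "\<And>r. 0 \<le> r \<Longrightarrow> r < s \<Longrightarrow> along y r > 0"
  shows "along y s = rho f0 s * f0 y"
proof (cases "s = 0")
  case True
  then show ?thesis
    using tail_mass_pos[of 0 y] s y by (simp add: along_0 rho_eq_tail_mass)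
next
  case False
  with s have "0 < s" by simp
  have tail_pos: "tail_mass f0 r > 0" if "0 \<le> r" "r \<le> s" for r
    using that s y by (intro tail_mass_pos[of r y]) auto
  have "along y s / tail_mass f0 s = along y 0 / tail_mass f0 0"
    using \<open>0 < s\<close>
  proof (rule DERIV_isconst_end)
    have "continuous_on {0..s} (tail_mass f0)"
      by (rule DERIV_continuous_on[OF DERIV_subset[OF tail_mass_has_derivative]]) auto
    then show "continuous_on {0..s} (\<lambda>r. along y r / tail_mass f0 r)"
      using tail_pos s by (intro continuous_intros along_continuous) (auto simp: less_imp_neq[symmetric])
    fix r assume r: "0 < r" "r < s"
    define c where "c = along y r / f0 y"
    have proportional: "along z r = c * f0 z" if "r \<le> z" for z
      unfolding c_def using r s pos that by (intro along_proportional) auto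
    have "c > 0" using r pos[of r] y by (simp add: c_def)
    have f_r: "f x r = c * f0 (x + r)" if "0 \<le> x" for x
      using proportional[of "x + r"] that by (simp add: along_def)
    have "mass f r = (LBINT x:{0<..}. c * f0 (x + r))"
      unfolding mass_def by (rule set_lebesgue_integral_cong) (auto simp: f_r)
    also have "\<dots> = c * tail_mass f0 r"
      by (simp add: tail_mass_def set_integral_shift)
    finally have a: "f 0 r / mass f r = f0 r / tail_mass f0 r"
      using \<open>c > 0\<close> f_r[of 0] by simp
    have "(tail_mass f0 has_real_derivative - f0 r) (at r)"
      using tail_mass_has_derivative[of r] r at_within_interior[of r "{0..}"] by simp
    then have "((\<lambda>r. along y r / tail_mass f0 r) has_real_derivative
        ((- (f0 r / tail_mass f0 r) * along y r) * tail_mass f0 r - along y r * (- f0 r)) / (tail_mass f0 r * tail_mass f0 r)) (at r)"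
      using r s tail_pos[of r] along_derivative[of r y] by (intro DERIV_divide) (auto simp: a)
    then show "((\<lambda>r. along y r / tail_mass f0 r) has_real_derivative 0) (at r)"
      using tail_pos[of r] r by simp
  qed
  then show ?thesis
    using tail_pos[of s] tail_pos[of 0] s along_0[of y] by (simp add: rho_eq_tail_mass field_simps)
qed

text \<open>
  At a first zero \<open>s\<close> the formula holds by the preceding lemma, but it is positive because
  \<open>s < y\<close> leaves mass near \<open>y\<close> in the tail.
\<close>

lemma along_pos:
  assumes t: "0 \<le> t" "t < y" and y: "f0 y > 0"
  shows "along y t > 0"
proof (rule ccontr)
  assume "\<not> along y t > 0"
  with along_nonneg[of t y] t have "along y t = 0" by simp
  let ?Z = "{r \<in> {0..t}. along y r = 0}"
  have "closed ?Z"
    using t by (intro continuous_closed_preimage_constant along_continuous) auto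
  then have "compact ?Z"
    by (intro compact_eq_bounded_closed[THEN iffD2] conjI bounded_subset[OF bounded_closed_interval[of 0 t]]) auto
  moreover have "?Z \<noteq> {}" using \<open>along y t = 0\<close> t by auto
  ultimately obtain s where s: "s \<in> ?Z" "\<And>r. r \<in> ?Z \<Longrightarrow> s \<le> r"
    using compact_attains_inf[of ?Z] by blast
  have pos: "along y r > 0" if "0 \<le> r" "r < s" for r
    using s(2)[of r] s(1) along_nonneg[of r y] that t by (cases "along y r = 0") auto
  have "along y s = rho f0 s * f0 y"
    using s(1) t y pos by (intro along_eq_while_positive) auto
  moreover have "rho f0 s > 0"
    using s(1) t y by (auto simp: rho_eq_tail_mass intro!: divide_pos_pos tail_mass_pos[of _ y])
  ultimately show False using s(1) y by auto
qed

text \<open>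
  A characteristic that starts at \<open>0\<close> remains at \<open>0\<close>, being nonnegative and decreasing; any other one
  stays positive up to time \<open>t < x + t\<close>.
\<close>

lemma f_eq_interior:
  assumes "0 < x" "0 \<le> t"
  shows "f x t = sol_formula f0 x t"
proof (cases "f0 (x + t) = 0")
  case True
  then show ?thesis
    using along_le[of t "x + t"] along_nonneg[of t "x + t"] assms by (simp add: along_def sol_formula_def)
next
  case False
  then have "f0 (x + t) > 0" using nonneg[of "x + t"] assms by simp
  then have "along (x + t) t = rho f0 t * f0 (x + t)"
    using assms by (intro along_eq_while_positive along_pos) auto
  then show ?thesis by (simp add: along_def sol_formula_def)
qed

text \<open>
  The characteristic through \<open>(0, t)\<close> has reached the boundary at time \<open>t\<close>; there the
  identity is the limit of the one for \<open>x > 0\<close>.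
\<close>

theorem solution_unique:
  assumes x: "0 \<le> x" and t: "0 \<le> t"
  shows "f x t = sol_formula f0 x t"
proof (cases "x = 0")
  case True
  have at_right: "(g \<longlongrightarrow> g 0) (at_right 0)" if "continuous_on {0..} g" for g :: "real \<Rightarrow> real"
    using bspec[OF that[unfolded continuous_on_def], of 0] by (simp add: at_within_Ici_at_right)
  have "continuous_on {0..} (\<lambda>x. (x, t))"
    by (intro continuous_intros)
  from continuous_on_compose2[OF f_continuous this] have "continuous_on {0..} (\<lambda>x. f x t)"
    using t by auto
  then have lim_f: "((\<lambda>x. f x t) \<longlongrightarrow> f 0 t) (at_right 0)"
    by (rule at_right)
  have "continuous_on {0..} (\<lambda>x. sol_formula f0 x t)"
    unfolding sol_formula_def using t
    by (intro continuous_intros continuous_on_compose2[OF continuous]) auto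
  then have lim_formula: "((\<lambda>x. sol_formula f0 x t) \<longlongrightarrow> sol_formula f0 0 t) (at_right 0)"
    by (rule at_right)
  have "\<forall>\<^sub>F x in at_right 0. sol_formula f0 x t = f x t"
    using eventually_at_right_less[of "0::real"] by eventually_elim (simp add: f_eq_interior t)
  from Lim_transform_eventually[OF lim_formula this] have "f 0 t = sol_formula f0 0 t"
    using tendsto_unique[OF trivial_limit_at_right_real lim_f] by blast
  then show ?thesis using True by simp
qed (use assms in \<open>simp add: f_eq_interior\<close>)

end

section \<open>Well-posedness and the dynamical system\<close>

theorem theorem1:
  shows "(\<forall>f0 :: real \<Rightarrow> real.
            set_integrable lborel {0<..} f0 \<and> (\<forall>x\<ge>0. 0 \<le> f0 x) \<and> C1_on {0..} f0 \<longrightarrow>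
              classical_solution f0 (sol_formula f0) \<and>
              (\<forall>f. classical_solution f0 f \<longrightarrow>
                 (\<forall>x\<ge>0. \<forall>t\<ge>0. f x t = sol_formula f0 x t)))
       \<and> continuous_dynamical_system_on L1_plus flow"
proof (intro conjI allI impI flow_dynamical_system)
  fix f0 :: "real \<Rightarrow> real"
  assume f0: "set_integrable lborel {0<..} f0 \<and> (\<forall>x\<ge>0. 0 \<le> f0 x) \<and> C1_on {0..} f0"
  then interpret kinetic_datum f0
    by unfold_locales (auto intro: C1_on_imp_continuous_on)
  show "classical_solution f0 (sol_formula f0)"
    using f0 by (intro sol_formula_classical_solution) simp
  fix f x t assume "classical_solution f0 f" and "0 \<le> (x :: real)" "0 \<le> (t :: real)"
  then interpret kinetic_solution f0 f by unfold_locales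
  show "f x t = sol_formula f0 x t"
    by (rule solution_unique) fact+
qed

end
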